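(* Let $T:V\to\mathfrak g$ be a relative Rota-Baxter operator on an $n$-LieRep pair $(\mathfrak g,[-,\cdots,-]_{\mathfrak g};\rho)$. Then for a linear map $T':V\to\mathfrak g$, $T+T'$ is a relative Rota-Baxter operator (on the same $n$-LieRep pair) if and only if $T'$ is a Maurer-Cartan element of the twisted $L_\infty$-algebra $(C^*(V,\mathfrak g),l_1^T,\cdots,l_n^T)$, that is, $T'$ satisfies the Maurer-Cartan equation $$l_1^T(T')+\frac12l_2^T(T',T')+\frac1{3!}l_3^T(T',T',T')+\cdots+\frac1{n!}l_n^T(\underbrace{T',\cdots,T'}_n)=0.$$
   Context: All vector spaces are finite dimensional over an algebraically closed field $\mathbb K$ of characteristic $0$; $n\ge 2$ is an integer; a hat denotes omission. An $n$-Lie algebra is a vector space $\mathfrak g$ with a skew-symmetric linear map $\mu=[-,\cdots,-]_{\mathfrak g}:\wedge^n\mathfrak g\to\mathfrak g$ such that $[x_1,\cdots,x_{n-1},[y_1,\cdots,y_n]]=\sum_{i=1}^n[y_1,\cdots,y_{i-1},[x_1,\cdots,x_{n-1},y_i],y_{i+1},\cdots,y_n]$. A representation of it on $V$ is a linear map $\rho:\wedge^{n-1}\mathfrak g\to\mathfrak{gl}(V)$ with (1) $[\rho(\mathfrak X),\rho(\mathfrak Y)]=\rho(\mathfrak X\circ\mathfrak Y)$ (commutator on the left), where for $\mathfrak X=x_1\wedge\cdots\wedge x_{n-1}$, $\mathfrak Y=y_1\wedge\cdots\wedge y_{n-1}$, $\mathfrak X\circ\mathfrak Y=\sum_{i=1}^{n-1}y_1\wedge\cdots\wedge[x_1,\cdots,x_{n-1},y_i]_{\mathfrak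 g}\wedge\cdots\wedge y_{n-1}$; and (2) $\rho(x_1,\cdots,x_{n-2},[y_1,\cdots,y_n]_{\mathfrak g})=\sum_{i=1}^n(-1)^{n-i}\rho(y_1,\cdots,\widehat{y_i},\cdots,y_n)\rho(x_1,\cdots,x_{n-2},y_i)$. An $n$-LieRep pair $(\mathfrak g,[-,\cdots,-]_{\mathfrak g};\rho)$ is an $n$-Lie algebra together with a representation $\rho$ on a vector space $V$. A relative Rota-Baxter operator on the $n$-LieRep pair is a linear map $T:V\to\mathfrak g$ with $[Tv_1,\cdots,Tv_n]_{\mathfrak g}=\sum_{i=1}^n(-1)^{n-i}T(\rho(Tv_1,\cdots,\widehat{Tv_i},\cdots,Tv_n)(v_i))$ for all $v_i\in V$. For a vector space $W$, $\otimes^p(\wedge^{n-1}W)\wedge W$ means $W$ if $p=0$ and $\otimes^{p-1}(\wedge^{n-1}W)\otimes\wedge^nW$ if $p\ge1$; a map on it is written $P(\mathfrak X_1,\cdots,\mathfrak X_p,x)$ with $\mathfrak X_i\in\wedge^{n-1}W$, $x\in W$. Put $C^p(W,W)=\mathrm{Hom}(\otimes^p(\wedge^{n-1}W)\wedge W,W)$ (degree $p$). $\bigoplus_{p\ge0}C^p(W,W)$ is a graded Lie algebra under $[P,Q]_{n\text{-Lie}}=P\circ Q-(-1)^{pq}Q\circ P$ for $P\in C^p$, $Q\in C^q$, where, with $\mathfrak X_i=x_i^1\wedge\cdots\wedge x_i^{n-1}$, $$(P\circ Q)(\mathfrak X_1,\cdots,\mathfrak X_{p+q},x)=\sum_{k=1}^p(-1)^{(k-1)q}\sum_{\sigma\in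 S(k-1,q)}(-1)^\sigma\sum_{i=1}^{n-1}P(\mathfrak X_{\sigma(1)},\cdots,\mathfrak X_{\sigma(k-1)},x_{k+q}^1\wedge\cdots\wedge x_{k+q}^{i-1}\wedge Q(\mathfrak X_{\sigma(k)},\cdots,\mathfrak X_{\sigma(k+q-1)},x_{k+q}^i)\wedge x_{k+q}^{i+1}\wedge\cdots\wedge x_{k+q}^{n-1},\mathfrak X_{k+q+1},\cdots,\mathfrak X_{p+q},x)$$ $$+\sum_{\sigma\in S(p,q)}(-1)^{pq}(-1)^\sigma P(\mathfrak X_{\sigma(1)},\cdots,\mathfrak X_{\sigma(p)},Q(\mathfrak X_{\sigma(p+1)},\cdots,\mathfrak X_{\sigma(p+q)},x)),$$ and $S(i,j)$ is the set of $(i,j)$-shuffles. Let $C^m(V,\mathfrak g)=\mathrm{Hom}(\otimes^m(\wedge^{n-1}V)\wedge V,\mathfrak g)$ (degree $m$), $C^*(V,\mathfrak g)=\bigoplus_{m\ge0}C^m(V,\mathfrak g)$, viewed inside $\bigoplus_mC^m(W,W)$ with $W=\mathfrak g\oplus V$ by applying $P$ to the $V$-components of the arguments. Let $\mu+\rho\in C^1(W,W)$ be the map $(x_1+u_1,\cdots,x_n+u_n)\mapsto[x_1,\cdots,x_n]_{\mathfrak g}+\sum_{i=1}^n(-1)^{n-i}\rho(x_1,\cdots,\widehat{x_i},\cdots,x_n)(u_i)$. The $n$-ary bracket $\{P_1,\cdots,P_n\}=[\cdots[[\mu+\rho,P_1]_{n\text{-Lie}},P_2]_{n\text{-Lie}},\cdots,P_n]_{n\text{-Lie}}$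 makes $C^*(V,\mathfrak g)$ a Lie $n$-algebra (an $L_\infty$-algebra with only the $n$-ary bracket nonzero, with graded symmetric brackets of degree $1$) whose Maurer-Cartan elements (degree $0$ elements $\alpha$ with $\frac1{n!}\{\alpha,\cdots,\alpha\}=0$) are the relative Rota-Baxter operators. Twisting by the Maurer-Cartan element $T$ gives the $L_\infty$-algebra with brackets $$l_k^T(P_1,\cdots,P_k)=\frac1{(n-k)!}\{\underbrace{T,\cdots,T}_{n-k},P_1,\cdots,P_k\}\ (1\le k\le n),\qquad l_k^T=0\ (k\ge n+1).$$ A Maurer-Cartan element of an $L_\infty$-algebra $(L,\{l_k\})$ is a degree $0$ element $\alpha$ with $\sum_{k\ge1}\frac1{k!}l_k(\alpha,\cdots,\alpha)=0$. *)

theory Defs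
  imports "HOL-Analysis.Product_Vector" "HOL-Library.Function_Algebras"
    "HOL-Combinatorics.Permutations" "HOL-Computational_Algebra.Polynomial"
begin

text \<open>
  Vector spaces are types with an explicit scalar multiplication.  A linear map out of an
  exterior power \<open>\<Lambda>\<^sup>m U\<close> is encoded, by the universal property, as a map on lists that is
  multilinear and alternating on lists of length \<open>m\<close>.
\<close>

definition alternating_map ::
  "nat \<Rightarrow> ('k::field \<Rightarrow> 'u::ab_group_add \<Rightarrow> 'u) \<Rightarrow> ('k \<Rightarrow> 'z::ab_group_add \<Rightarrow> 'z)
    \<Rightarrow> ('u list \<Rightarrow> 'z) \<Rightarrow> bool" where
  "alternating_map m sU sZ f \<longleftrightarrow>
     (\<forall>xs i. length xs = m \<and> i < m \<longrightarrow> Vector_Spaces.linear sU sZ (\<lambda>y. f (xs[i := y]))) \<and>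
     (\<forall>xs. length xs = m \<and> \<not> distinct xs \<longrightarrow> f xs = 0)"

(* omission of the i-th entry, counted from 1 *)
definition omit :: "nat \<Rightarrow> 'a list \<Rightarrow> 'a list" where
  "omit i xs = take (i - 1) xs @ drop i xs"

definition n_lie_algebra ::
  "nat \<Rightarrow> ('k::field \<Rightarrow> 'g::ab_group_add \<Rightarrow> 'g) \<Rightarrow> ('g list \<Rightarrow> 'g) \<Rightarrow> bool" where
  "n_lie_algebra n sg br \<longleftrightarrow>
     alternating_map n sg sg br \<and>
     (\<forall>X Y. length X = n - 1 \<and> length Y = n \<longrightarrow>
        br (X @ [br Y]) = (\<Sum>i<n. br (Y[i := br (X @ [Y ! i])])))"

definition n_lie_representation ::
  "nat \<Rightarrow> ('k::field \<Rightarrow> 'g::ab_group_add \<Rightarrow> 'g) \<Rightarrow> ('k \<Rightarrow> 'v::ab_group_add \<Rightarrow> 'v)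
    \<Rightarrow> ('g list \<Rightarrow> 'g) \<Rightarrow> ('g list \<Rightarrow> 'v \<Rightarrow> 'v) \<Rightarrow> bool" where
  "n_lie_representation n sg sV br \<rho> \<longleftrightarrow>
     (\<forall>X. length X = n - 1 \<longrightarrow> Vector_Spaces.linear sV sV (\<rho> X)) \<and>
     (\<forall>v. alternating_map (n - 1) sg sV (\<lambda>X. \<rho> X v)) \<and>
     (\<forall>X Y v. length X = n - 1 \<and> length Y = n - 1 \<longrightarrow>
        \<rho> X (\<rho> Y v) - \<rho> Y (\<rho> X v) = (\<Sum>i<n - 1. \<rho> (Y[i := br (X @ [Y ! i])]) v)) \<and>
     (\<forall>X Y v. length X = n - 2 \<and> length Y = n \<longrightarrow>
        \<rho> (X @ [br Y]) v =
          (\<Sum>i=1..n. sV ((-1) ^ (n - i)) (\<rho> (omit i Y) (\<rho> (X @ [Y ! (i - 1)]) v))))"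

definition n_lierep_pair ::
  "nat \<Rightarrow> ('k::field \<Rightarrow> 'g::ab_group_add \<Rightarrow> 'g) \<Rightarrow> ('k \<Rightarrow> 'v::ab_group_add \<Rightarrow> 'v)
    \<Rightarrow> ('g list \<Rightarrow> 'g) \<Rightarrow> ('g list \<Rightarrow> 'v \<Rightarrow> 'v) \<Rightarrow> bool" where
  "n_lierep_pair n sg sV br \<rho> \<longleftrightarrow>
     n_lie_algebra n sg br \<and> n_lie_representation n sg sV br \<rho>"

definition relative_rota_baxter ::
  "nat \<Rightarrow> ('k::field \<Rightarrow> 'g::ab_group_add \<Rightarrow> 'g) \<Rightarrow> ('k \<Rightarrow> 'v::ab_group_add \<Rightarrow> 'v)
    \<Rightarrow> ('g list \<Rightarrow> 'g) \<Rightarrow> ('g list \<Rightarrow> 'v \<Rightarrow> 'v) \<Rightarrow> ('v \<Rightarrow> 'g) \<Rightarrow> bool" where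
  "relative_rota_baxter n sg sV br \<rho> T \<longleftrightarrow>
     Vector_Spaces.linear sV sg T \<and>
     (\<forall>vs. length vs = n \<longrightarrow>
        br (map T vs) =
          (\<Sum>i=1..n. sg ((-1) ^ (n - i)) (T (\<rho> (map T (omit i vs)) (vs ! (i - 1))))))"

text \<open>
  An element \<open>P\<close> of a direct sum \<open>\<Oplus>\<^sub>p Hom(\<otimes>\<^sup>p(\<Lambda>\<^sup>n\<^sup>-\<^sup>1 U) \<and> U, Z)\<close> is a function of a list of blocks
  \<open>[\<XX>\<^sub>1, \<dots>, \<XX>\<^sub>p]\<close> (lists of length \<open>n - 1\<close>) and of a last argument \<open>x\<close>.  Its degree \<open>p\<close>
  component is its restriction to lists of \<open>p\<close> blocks, so no separate index for the degree
  is needed.  The value on lists with a block of the wrong length is fixed to be \<open>0\<close>, so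
  that equality of functions is equality of cochains.
\<close>

type_synonym ('u, 'z) cochain = "'u list list \<Rightarrow> 'u \<Rightarrow> 'z"

definition blocks :: "nat \<Rightarrow> 'u list list \<Rightarrow> bool" where
  "blocks n Xs \<longleftrightarrow> (\<forall>X\<in>set Xs. length X = n - 1)"

(* Hom(\<otimes>\<^sup>p(\<Lambda>\<^sup>n\<^sup>-\<^sup>1 U) \<and> U, Z); for p > 0 the last block together with x is an element of \<Lambda>\<^sup>n U *)
definition cochains ::
  "nat \<Rightarrow> ('k::field \<Rightarrow> 'u::ab_group_add \<Rightarrow> 'u) \<Rightarrow> ('k \<Rightarrow> 'z::ab_group_add \<Rightarrow> 'z)
    \<Rightarrow> nat \<Rightarrow> ('u, 'z) cochain set" where
  "cochains n sU sZ p = {P.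
     (\<forall>Xs x. \<not> (length Xs = p \<and> blocks n Xs) \<longrightarrow> P Xs x = 0) \<and>
     (\<forall>Xs. length Xs = p \<and> blocks n Xs \<longrightarrow> Vector_Spaces.linear sU sZ (P Xs)) \<and>
     (\<forall>Xs j x. length Xs = p \<and> blocks n Xs \<and> j < p \<longrightarrow>
        alternating_map (n - 1) sU sZ (\<lambda>X. P (Xs[j := X]) x)) \<and>
     (\<forall>Xs x. length Xs = p \<and> blocks n Xs \<and> p > 0 \<and> \<not> distinct (last Xs @ [x]) \<longrightarrow>
        P Xs x = 0)}"

definition cochain_scale ::
  "('k \<Rightarrow> 'z \<Rightarrow> 'z) \<Rightarrow> 'k \<Rightarrow> ('u, 'z) cochain \<Rightarrow> ('u, 'z) cochain" where
  "cochain_scale sZ c P = (\<lambda>Xs x. sZ c (P Xs x))"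

definition shuffle_perms :: "nat \<Rightarrow> nat \<Rightarrow> (nat \<Rightarrow> nat) set" where
  "shuffle_perms i j = {\<sigma>. \<sigma> permutes {1..i + j} \<and>
     strict_mono_on {1..i} \<sigma> \<and> strict_mono_on {i + 1..i + j} \<sigma>}"

text \<open>\<open>P \<circ> Q\<close> for \<open>P\<close> of degree \<open>p\<close> and \<open>Q\<close> of degree \<open>q\<close>; only the components of \<open>P\<close> and \<open>Q\<close> in
  these degrees enter.  The blocks \<open>X j\<close> are numbered from 1, the entries of a block from 0.\<close>

definition nlie_circ ::
  "nat \<Rightarrow> ('k::field \<Rightarrow> 'w::ab_group_add \<Rightarrow> 'w) \<Rightarrow> nat \<Rightarrow> nat
    \<Rightarrow> ('w, 'w) cochain \<Rightarrow> ('w, 'w) cochain \<Rightarrow> ('w, 'w) cochain" where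
  "nlie_circ n s p q P Q = (\<lambda>Xs x.
     let X = (\<lambda>j. Xs ! (j - 1)) in
       (\<Sum>k=1..p. s ((-1) ^ ((k - 1) * q))
          (\<Sum>\<sigma>\<in>shuffle_perms (k - 1) q. s (of_int (sign \<sigma>))
            (\<Sum>i<n - 1.
               P (map (\<lambda>j. X (\<sigma> j)) [1..<k]
                  @ [(X (k + q))[i := Q (map (\<lambda>j. X (\<sigma> j)) [k..<k + q]) (X (k + q) ! i)]]
                  @ map X [k + q + 1..<p + q + 1]) x)))
     + (\<Sum>\<sigma>\<in>shuffle_perms p q. s ((-1) ^ (p * q) * of_int (sign \<sigma>))
          (P (map (\<lambda>j. X (\<sigma> j)) [1..<p + 1])
             (Q (map (\<lambda>j. X (\<sigma> j)) [p + 1..<p + q + 1]) x))))"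

text \<open>The bilinear extension of \<open>[P, Q] = P \<circ> Q - (-1)\<^sup>p\<^sup>q Q \<circ> P\<close> to the direct sum: its component
  of degree \<open>m\<close> is the sum of the brackets of the components of degrees \<open>p + q = m\<close>.\<close>

definition nlie_bracket ::
  "nat \<Rightarrow> ('k::field \<Rightarrow> 'w::ab_group_add \<Rightarrow> 'w)
    \<Rightarrow> ('w, 'w) cochain \<Rightarrow> ('w, 'w) cochain \<Rightarrow> ('w, 'w) cochain" where
  "nlie_bracket n s P Q = (\<lambda>Xs x.
     if blocks n Xs then
       \<Sum>q\<le>length Xs. let p = length Xs - q in
         nlie_circ n s p q P Q Xs x - s ((-1) ^ (p * q)) (nlie_circ n s q p Q P Xs x)
     else 0)"

(* the degree 1 cochain \<mu> + \<rho> on g \<oplus> V *)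
definition mu_plus_rho ::
  "nat \<Rightarrow> ('k::field \<Rightarrow> 'v::ab_group_add \<Rightarrow> 'v) \<Rightarrow> ('g::ab_group_add list \<Rightarrow> 'g)
    \<Rightarrow> ('g list \<Rightarrow> 'v \<Rightarrow> 'v) \<Rightarrow> ('g \<times> 'v, 'g \<times> 'v) cochain" where
  "mu_plus_rho n sV br \<rho> = (\<lambda>Xs x.
     if length Xs = 1 \<and> blocks n Xs then
       let ws = hd Xs @ [x] in
         (br (map fst ws),
          \<Sum>i=1..n. sV ((-1) ^ (n - i)) (\<rho> (omit i (map fst ws)) (snd (ws ! (i - 1)))))
     else 0)"

(* inclusion of C*(V,g) into C*(W,W), W = g \<oplus> V *)
definition lift_cochain ::
  "('v, 'g) cochain \<Rightarrow> ('g::zero \<times> 'v::zero, 'g \<times> 'v) cochain" where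
  "lift_cochain P = (\<lambda>Xs x. (P (map (map snd) Xs) (snd x), 0))"

(* C^m(V,g) inside C^m(W,W) *)
definition cochains_V_g ::
  "nat \<Rightarrow> ('k::field \<Rightarrow> 'g::ab_group_add \<Rightarrow> 'g) \<Rightarrow> ('k \<Rightarrow> 'v::ab_group_add \<Rightarrow> 'v)
    \<Rightarrow> nat \<Rightarrow> ('g \<times> 'v, 'g \<times> 'v) cochain set" where
  "cochains_V_g n sg sV m = lift_cochain ` cochains n sV sg m"

(* a linear map V \<rightarrow> g as an element of C^0(V,g), inside C^0(W,W) *)
definition degree0 :: "('v \<Rightarrow> 'g) \<Rightarrow> ('g::zero \<times> 'v::zero, 'g \<times> 'v) cochain" where
  "degree0 T = lift_cochain (\<lambda>Xs v. if Xs = [] then T v else 0)"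

(* {P_1, ..., P_n} for a list of cochains *)
definition nary_bracket ::
  "nat \<Rightarrow> ('k::field \<Rightarrow> 'g::ab_group_add \<Rightarrow> 'g) \<Rightarrow> ('k \<Rightarrow> 'v::ab_group_add \<Rightarrow> 'v)
    \<Rightarrow> ('g list \<Rightarrow> 'g) \<Rightarrow> ('g list \<Rightarrow> 'v \<Rightarrow> 'v)
    \<Rightarrow> ('g \<times> 'v, 'g \<times> 'v) cochain list \<Rightarrow> ('g \<times> 'v, 'g \<times> 'v) cochain" where
  "nary_bracket n sg sV br \<rho> Ps =
     foldl (nlie_bracket n (module_prod.scale sg sV)) (mu_plus_rho n sV br \<rho>) Ps"

(* l_k^T, applied to a list of k cochains *)
definition twisted_bracket ::
  "nat \<Rightarrow> ('k::field_char_0 \<Rightarrow> 'g::ab_group_add \<Rightarrow> 'g) \<Rightarrow> ('k \<Rightarrow> 'v::ab_group_add \<Rightarrow> 'v)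
    \<Rightarrow> ('g list \<Rightarrow> 'g) \<Rightarrow> ('g list \<Rightarrow> 'v \<Rightarrow> 'v) \<Rightarrow> ('v \<Rightarrow> 'g)
    \<Rightarrow> nat \<Rightarrow> ('g \<times> 'v, 'g \<times> 'v) cochain list \<Rightarrow> ('g \<times> 'v, 'g \<times> 'v) cochain" where
  "twisted_bracket n sg sV br \<rho> T k Ps =
     (if 1 \<le> k \<and> k \<le> n then
        cochain_scale (module_prod.scale sg sV) (1 / fact (n - k))
          (nary_bracket n sg sV br \<rho> (replicate (n - k) (degree0 T) @ Ps))
      else 0)"

text \<open>Maurer-Cartan elements for a graded space with homogeneous parts \<open>L m\<close>, scalar multiplication
  \<open>s\<close> and brackets \<open>l k\<close>, \<open>k \<ge> 1\<close>.  Only finitely many terms of the Maurer-Cartan series may be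
  nonzero, so that the sum is meaningful.\<close>

definition maurer_cartan ::
  "('k::field_char_0 \<Rightarrow> 'a::comm_monoid_add \<Rightarrow> 'a) \<Rightarrow> (nat \<Rightarrow> 'a set)
    \<Rightarrow> (nat \<Rightarrow> 'a list \<Rightarrow> 'a) \<Rightarrow> 'a \<Rightarrow> bool" where
  "maurer_cartan s L l \<alpha> \<longleftrightarrow>
     \<alpha> \<in> L 0 \<and>
     finite {k. k \<ge> 1 \<and> l k (replicate k \<alpha>) \<noteq> 0} \<and>
     (\<Sum>k | k \<ge> 1 \<and> l k (replicate k \<alpha>) \<noteq> 0. s (1 / fact k) (l k (replicate k \<alpha>))) = 0"

end

theory Submission
  imports Defs
begin

text \<open>
  Bracketing a degree 1 cochain \<open>\<phi>\<close> with a linear map \<open>S : V \<rightarrow> g\<close>, extended by zero to an operator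
  \<open>D\<close> on \<open>g \<oplus> V\<close>, applies the derivation
  \<open>(\<delta>\<^sub>S \<phi>)(w\<^sub>1, \<dots>, w\<^sub>n) = \<Sum>\<^sub>i \<phi>(w\<^sub>1, \<dots>, D w\<^sub>i, \<dots>, w\<^sub>n) - D \<phi>(w\<^sub>1, \<dots>, w\<^sub>n)\<close>.
  These derivations are additive in \<open>S\<close>, and they commute because such operators compose to zero.
  By the binomial theorem the left-hand side of the Maurer-Cartan equation is therefore
  \<open>1/n! (\<delta>\<^sub>T\<^sub>+\<^sub>T\<^sub>'\<^sup>n - \<delta>\<^sub>T\<^sup>n)\<close> applied to \<open>\<mu> + \<rho>\<close>.  Moreover \<open>\<delta>\<^sub>S\<^sup>n (\<mu> + \<rho>)\<close> is \<open>n!\<close> times the defect of the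
  Rota-Baxter identity for \<open>S\<close>: write \<open>\<delta>\<^sub>S = L - R\<close> with \<open>R \<phi> = D \<circ> \<phi>\<close>; since \<open>R\<^sup>2 = 0\<close>, only
  \<open>L\<^sup>n - n L\<^sup>n\<^sup>-\<^sup>1 R\<close> survives, and since \<open>D\<^sup>2 = 0\<close>, \<open>L\<^sup>m\<close> is \<open>m!\<close> times the sum over the sets of \<open>m\<close>
  slots to which \<open>D\<close> is applied.
\<close>

section \<open>Binomial formula for commuting operators\<close>

lemma sum_apply: "(\<Sum>i\<in>A. f i) x = (\<Sum>i\<in>A. f i x)"
  by (induction A rule: infinite_finite_induct) auto

lemma module_pointwise: "module s \<Longrightarrow> module (\<lambda>c f x. s c (f x))"
  by (simp add: module_def fun_eq_iff)

text \<open>The splitting of \<open>C\<close> is asked only on \<open>M\<close> because derivations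
  are additive in the operator only on multiadditive maps. Linearity of \<open>C\<close> moves it
  past the coefficients to the terms \<open>t k m\<close>, which all lie in
  \<open>M\<close>.\<close>

lemma (in module) funpow_binomial:
  assumes A: "module_hom scale scale A" and B: "module_hom scale scale B"
    and C: "module_hom scale scale C"
    and comm: "\<And>y. A (B y) = B (A y)"
    and closedA: "\<And>y. y \<in> M \<Longrightarrow> A y \<in> M" and closedB: "\<And>y. y \<in> M \<Longrightarrow> B y \<in> M"
    and sum: "\<And>y. y \<in> M \<Longrightarrow> C y = A y + B y"
    and x: "x \<in> M"
  shows "(C ^^ n) x = (\<Sum>k\<le>n. of_nat (n choose k) *s (B ^^ k) ((A ^^ (n - k)) x))"
proof (induction n)
  case (Suc n)
  define t where "t k m = (B ^^ k) ((A ^^ m) x)" for k m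
  have A_pow_B: "A ((B ^^ k) y) = (B ^^ k) (A y)" for k y
    by (induction k) (simp_all add: comm)
  have t_mem: "t k m \<in> M" for k m
  proof -
    have "(A ^^ m) x \<in> M" by (induction m) (simp_all add: x closedA)
    then show ?thesis unfolding t_def by (induction k) (simp_all add: closedB)
  qed
  have C_t: "C (t k m) = t k (Suc m) + t (Suc k) m" for k m
    using sum[OF t_mem] by (simp add: t_def A_pow_B)
  \<comment> \<open>The coefficient \<open>n choose Suc n\<close> is zero, so the range can be
    enlarged before the term \<open>k = 0\<close> is split off. Pascal's rule then joins the two
    sums term by term.\<close>
  have shift: "(\<Sum>k\<le>n. of_nat (n choose k) *s t k (Suc n - k)) =
      t 0 (Suc n) + (\<Sum>k\<le>n. of_nat (n choose Suc k) *s t (Suc k) (n - k))"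
  proof -
    have "(\<Sum>k\<le>n. of_nat (n choose k) *s t k (Suc n - k)) =
        (\<Sum>k\<le>Suc n. of_nat (n choose k) *s t k (Suc n - k))" by (simp add: binomial_eq_0)
    also have "\<dots> = t 0 (Suc n) + (\<Sum>k\<le>n. of_nat (n choose Suc k) *s t (Suc k) (n - k))"
      by (subst sum.atMost_Suc_shift) simp
    finally show ?thesis .
  qed
  have "(C ^^ Suc n) x = (\<Sum>k\<le>n. of_nat (n choose k) *s (t k (Suc (n - k)) + t (Suc k) (n - k)))"
    using Suc.IH by (simp add: t_def[symmetric] module_hom.sum[OF C] module_hom.scale[OF C] C_t)
  also have "\<dots> = (\<Sum>k\<le>n. of_nat (n choose k) *s t k (Suc n - k)) +
      (\<Sum>k\<le>n. of_nat (n choose k) *s t (Suc k) (n - k))"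
    by (simp add: scale_right_distrib sum.distrib Suc_diff_le)
  also have "\<dots> = t 0 (Suc n) + (\<Sum>k\<le>n. of_nat (Suc n choose Suc k) *s t (Suc k) (n - k))"
    unfolding shift by (simp add: scale_left_distrib sum.distrib algebra_simps)
  also have "\<dots> = (\<Sum>k\<le>Suc n. of_nat (Suc n choose k) *s t k (Suc n - k))"
    by (subst sum.atMost_Suc_shift) simp
  finally show ?case by (simp add: t_def)
qed simp

section \<open>Derivations acting on multiadditive maps\<close>

definition slot_sum :: "('w \<Rightarrow> 'w) \<Rightarrow> ('w list \<Rightarrow> 'z) \<Rightarrow> 'w list \<Rightarrow> 'z::comm_monoid_add" where
  "slot_sum D \<phi> = (\<lambda>ws. \<Sum>i<length ws. \<phi> (ws[i := D (ws ! i)]))"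

text \<open>Up to sign, the natural action of an endomorphism \<open>D\<close> of W on W-valued
  multilinear maps.\<close>

definition deriv_map :: "('w \<Rightarrow> 'w) \<Rightarrow> ('w list \<Rightarrow> 'w) \<Rightarrow> 'w list \<Rightarrow> 'w::ab_group_add" where
  "deriv_map D \<phi> = (\<lambda>ws. slot_sum D \<phi> ws - D (\<phi> ws))"

definition multiadditive :: "('w::plus list \<Rightarrow> 'z::plus) \<Rightarrow> bool" where
  "multiadditive \<phi> \<longleftrightarrow>
     (\<forall>ws i a b. i < length ws \<longrightarrow> \<phi> (ws[i := a + b]) = \<phi> (ws[i := a]) + \<phi> (ws[i := b]))"

lemma multiadditiveD:
  "multiadditive \<phi> \<Longrightarrow> i < length ws \<Longrightarrow> \<phi> (ws[i := a + b]) = \<phi> (ws[i := a]) + \<phi> (ws[i := b])"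
  by (simp add: multiadditive_def)

lemma multiadditive_zero:
  fixes \<phi> :: "'w::group_add list \<Rightarrow> 'z::ab_group_add"
  assumes "multiadditive \<phi>" "0 \<in> set ws"
  shows "\<phi> ws = 0"
proof -
  obtain i where i: "i < length ws" "ws ! i = 0"
    using assms(2) by (auto simp: in_set_conv_nth)
  have "\<phi> (ws[i := 0 + 0]) = \<phi> (ws[i := 0]) + \<phi> (ws[i := 0])"
    using assms(1) i(1) by (rule multiadditiveD)
  moreover have "ws[i := 0] = ws"
    using i by (metis list_update_id)
  ultimately show ?thesis by simp
qed

text \<open>Keeps iterated derivations among the maps on which \<open>deriv_map\<close> is additive
  in its operator. If \<open>D\<close> hits the slot under test, its own additivity is used;
  otherwise the two updates are interchanged.\<close>

lemma multiadditive_deriv_map: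
  assumes "additive D" "multiadditive \<phi>"
  shows "multiadditive (deriv_map D \<phi>)"
  unfolding multiadditive_def
proof (intro allI impI)
  fix ws :: "'a list" and i a b assume i: "i < length ws"
  note add = multiadditiveD[OF assms(2)] additive.add[OF assms(1)]
  have slot: "\<phi> (ws[i := a + b, j := D (ws[i := a + b] ! j)]) =
      \<phi> (ws[i := a, j := D (ws[i := a] ! j)]) + \<phi> (ws[i := b, j := D (ws[i := b] ! j)])"
    if "j < length ws" for j
    using that i add by (cases "j = i") (simp_all add: list_update_swap[of i j])
  show "deriv_map D \<phi> (ws[i := a + b]) = deriv_map D \<phi> (ws[i := a]) + deriv_map D \<phi> (ws[i := b])"
    using i by (simp add: deriv_map_def slot_sum_def slot sum.distrib add algebra_simps)
qed

text \<open>Multiadditivity splits the entry \<open>D w + E w\<close> in each slot.\<close>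

lemma deriv_map_add_left:
  assumes "multiadditive \<phi>"
  shows "deriv_map (\<lambda>w. D w + E w) \<phi> = deriv_map D \<phi> + deriv_map E \<phi>"
  using multiadditiveD[OF assms]
  by (simp add: fun_eq_iff deriv_map_def slot_sum_def sum.distrib algebra_simps)

lemma slot_sum_commute:
  assumes "\<And>w. D (E w) = E (D w)"
  shows "slot_sum D (slot_sum E \<phi>) = slot_sum E (slot_sum D \<phi>)"
proof
  fix ws :: "'a list"
  have swap: "\<phi> (ws[i := D (ws ! i), j := E (ws[i := D (ws ! i)] ! j)]) =
      \<phi> (ws[j := E (ws ! j), i := D (ws[j := E (ws ! j)] ! i)])"
    if "i < length ws" "j < length ws" for i j
    using that by (cases "j = i") (simp_all add: assms list_update_swap[of i j])
  have "slot_sum D (slot_sum E \<phi>) ws =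
      (\<Sum>i<length ws. \<Sum>j<length ws. \<phi> (ws[j := E (ws ! j), i := D (ws[j := E (ws ! j)] ! i)]))"
    by (simp add: slot_sum_def swap)
  also have "\<dots> = slot_sum E (slot_sum D \<phi>) ws"
    by (subst sum.swap) (simp add: slot_sum_def)
  finally show "slot_sum D (slot_sum E \<phi>) ws = slot_sum E (slot_sum D \<phi>) ws" .
qed

lemma slot_sum_additive:
  assumes "additive D"
  shows "slot_sum E (\<lambda>ws. D (\<phi> ws)) ws = D (slot_sum E \<phi> ws)"
  by (simp add: slot_sum_def additive.sum[OF assms])

lemma slot_sum_diff:
  fixes \<phi> \<psi> :: "'w list \<Rightarrow> 'z::ab_group_add"
  shows "slot_sum E (\<lambda>ws. \<phi> ws - \<psi> ws) ws = slot_sum E \<phi> ws - slot_sum E \<psi> ws"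
  by (simp add: slot_sum_def sum_subtractf)

text \<open>Both sides expand into four terms. The slot sums commute, an additive outer operator
  passes through a slot sum, and the two outer operators commute by assumption.\<close>

lemma deriv_map_commute:
  assumes "additive D" "additive E" "\<And>w. D (E w) = E (D w)"
  shows "deriv_map D (deriv_map E \<phi>) = deriv_map E (deriv_map D \<phi>)"
  using slot_sum_commute[of D E \<phi>, OF assms(3)]
  by (simp add: fun_eq_iff deriv_map_def slot_sum_diff slot_sum_additive assms additive.diff)

lemma module_hom_slot_sum:
  assumes "module s"
  shows "module_hom (\<lambda>c f x. s c (f x)) (\<lambda>c f x. s c (f x)) (slot_sum D)"
proof -
  interpret module s by fact
  interpret F: module "\<lambda>c f x. s c (f x)" by (rule module_pointwise) fact
  show ?thesis
    by unfold_locales (auto simp: slot_sum_def fun_eq_iff sum.distrib scale_sum_right)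
qed

lemma module_hom_deriv_map:
  assumes "module_hom s s D"
  shows "module_hom (\<lambda>c f x. s c (f x)) (\<lambda>c f x. s c (f x)) (deriv_map D)"
proof -
  interpret module_hom s s D by fact
  interpret L: module_hom "\<lambda>c f x. s c (f x)" "\<lambda>c f x. s c (f x)" "slot_sum D"
    by (rule module_hom_slot_sum) unfold_locales
  show ?thesis
    by unfold_locales
      (use L.add L.scale in \<open>simp_all add: deriv_map_def fun_eq_iff add scale m1.scale_right_diff_distrib algebra_simps\<close>)
qed

section \<open>Powers of slot sums and of derivations\<close>

definition apply_on :: "('w \<Rightarrow> 'w) \<Rightarrow> nat set \<Rightarrow> 'w list \<Rightarrow> 'w list" where
  "apply_on D A ws = map (\<lambda>i. if i \<in> A then D (ws ! i) else ws ! i) [0..<length ws]"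

lemma length_apply_on [simp]: "length (apply_on D A ws) = length ws"
  by (simp add: apply_on_def)

lemma nth_apply_on: "i < length ws \<Longrightarrow> apply_on D A ws ! i = (if i \<in> A then D (ws ! i) else ws ! i)"
  by (simp add: apply_on_def)

lemma apply_on_update:
  assumes "i < length ws" "i \<notin> A"
  shows "apply_on D A (ws[i := D (ws ! i)]) = apply_on D (insert i A) ws"
  using assms by (auto simp: list_eq_iff_nth_eq nth_apply_on nth_list_update)

text \<open>Double counting: \<open>(i, A)\<close> with \<open>i\<close> outside \<open>A\<close>
  corresponds to \<open>(B, i)\<close> with \<open>i\<close> in \<open>B = insert i A\<close>, so
  each \<open>B\<close> occurs \<open>Suc m\<close> times.\<close>

lemma sum_insert_subsets:
  fixes f :: "'a set \<Rightarrow> 'b::ab_group_add"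
  assumes "finite N" "module s"
  shows "(\<Sum>i\<in>N. \<Sum>A | A \<subseteq> N \<and> card A = m \<and> i \<notin> A. f (insert i A)) =
    s (of_nat (Suc m)) (\<Sum>B | B \<subseteq> N \<and> card B = Suc m. f B)"
proof -
  interpret module s by fact
  have fin: "finite {A. A \<subseteq> N \<and> P A}" for P
    using assms(1) by (auto intro: finite_subset[of _ "Pow N"])
  have finB: "finite B" if "B \<subseteq> N" for B
    using assms(1) that by (rule rev_finite_subset)
  have "(\<Sum>i\<in>N. \<Sum>A | A \<subseteq> N \<and> card A = m \<and> i \<notin> A. f (insert i A)) =
      (\<Sum>(i, A)\<in>(SIGMA i:N. {A. A \<subseteq> N \<and> card A = m \<and> i \<notin> A}). f (insert i A))"
    using assms(1) fin by (subst sum.Sigma) auto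
  also have "\<dots> = (\<Sum>(B, i)\<in>(SIGMA B:{B. B \<subseteq> N \<and> card B = Suc m}. B). f B)"
    by (rule sum.reindex_bij_witness
        [where i = "\<lambda>(B, i). (i, B - {i})" and j = "\<lambda>(i, A). (insert i A, i)"])
      (auto simp: insert_absorb finB)
  also have "\<dots> = (\<Sum>B | B \<subseteq> N \<and> card B = Suc m. \<Sum>i\<in>B. f B)"
    using fin finB by (subst sum.Sigma) auto
  also have "\<dots> = (\<Sum>B | B \<subseteq> N \<and> card B = Suc m. s (of_nat (Suc m)) (f B))"
    by (rule sum.cong) (auto simp: sum_constant_scale)
  finally show ?thesis by (simp only: scale_sum_right)
qed

text \<open>Hitting a slot twice produces a zero entry, so only sequences of distinct slots
  contribute, and each set of \<open>m\<close> slots arises from \<open>m!\<close> orders.\<close>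

lemma slot_sum_funpow:
  fixes \<phi> :: "'w::ab_group_add list \<Rightarrow> 'z::ab_group_add"
  assumes "module s" and D: "\<And>w. D (D w) = 0" and \<phi>: "multiadditive \<phi>"
  shows "(slot_sum D ^^ m) \<phi> ws =
    s (fact m) (\<Sum>A | A \<subseteq> {..<length ws} \<and> card A = m. \<phi> (apply_on D A ws))"
proof (induction m arbitrary: ws)
  case 0
  interpret module s by fact
  have "{A. A \<subseteq> {..<length ws} \<and> card A = 0} = {{}}"
    by (auto simp: finite_subset)
  then show ?case by (simp add: apply_on_def map_nth)
next
  case (Suc m)
  interpret module s by fact
  let ?N = "{..<length ws}"
  have vanish: "\<phi> (apply_on D A (ws[i := D (ws ! i)])) = 0" if "i < length ws" "i \<in> A" for i A
  proof (rule multiadditive_zero[OF \<phi>])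
    have "apply_on D A (ws[i := D (ws ! i)]) ! i = 0"
      using that by (simp add: nth_apply_on D)
    then show "0 \<in> set (apply_on D A (ws[i := D (ws ! i)]))"
      using that by (metis length_apply_on length_list_update nth_mem)
  qed
  \<comment> \<open>Unfolding the outermost slot sum changes the list, hence the induction over
    arbitrary \<open>ws\<close>.\<close>
  have "(slot_sum D ^^ Suc m) \<phi> ws =
      (\<Sum>i<length ws. s (fact m) (\<Sum>A | A \<subseteq> ?N \<and> card A = m. \<phi> (apply_on D A (ws[i := D (ws ! i)]))))"
    by (subst funpow.simps, subst comp_apply, subst slot_sum_def) (simp add: Suc.IH)
  also have "\<dots> = s (fact m)
      (\<Sum>i<length ws. \<Sum>A | A \<subseteq> ?N \<and> card A = m \<and> i \<notin> A. \<phi> (apply_on D (insert i A) ws))"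
    unfolding scale_sum_right[symmetric]
  proof (rule arg_cong[where f = "s (fact m)"], rule sum.cong[OF refl])
    fix i assume "i \<in> ?N"
    then show "(\<Sum>A | A \<subseteq> ?N \<and> card A = m. \<phi> (apply_on D A (ws[i := D (ws ! i)]))) =
        (\<Sum>A | A \<subseteq> ?N \<and> card A = m \<and> i \<notin> A. \<phi> (apply_on D (insert i A) ws))"
      by (intro sum.mono_neutral_cong_right)
        (auto simp: vanish apply_on_update intro: finite_subset[of _ "Pow ?N"])
  qed
  also have "\<dots> = s (fact (Suc m))
      (\<Sum>A | A \<subseteq> ?N \<and> card A = Suc m. \<phi> (apply_on D A ws))"
    by (subst sum_insert_subsets[OF _ assms(1)]) (simp_all add: mult.commute)
  finally show ?case .
qed


lemma module_hom_funpow: "module_hom s s f \<Longrightarrow> module_hom s s (f ^^ k)"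
  by (induction k) (auto simp: module_hom_def module_hom_axioms_def)

text \<open>The sets of all \<open>Suc n\<close> slots come from \<open>k = 0\<close> in the
  binomial sum, the complements of one slot from \<open>k = 1\<close>. Both carry the same factor,
  since \<open>Suc n\<close> times \<open>n!\<close> is \<open>(Suc n)!\<close>.\<close>

lemma deriv_map_funpow:
  fixes scale :: "'k::{comm_ring_1, semiring_char_0} \<Rightarrow> 'w::ab_group_add \<Rightarrow> 'w" (infixr "*s" 75)
  assumes D: "module_hom scale scale D" and sq: "\<And>w. D (D w) = 0"
    and \<phi>: "multiadditive \<phi>"
    and len: "length ws = Suc n"
  shows "(deriv_map D ^^ Suc n) \<phi> ws =
    fact (Suc n) *s (\<phi> (map D ws) - (\<Sum>i<Suc n. D (\<phi> (apply_on D ({..<Suc n} - {i}) ws))))"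
proof -
  interpret D: module_hom scale scale D by fact
  interpret F: module "\<lambda>c f x. c *s f x" by (rule module_pointwise) unfold_locales
  interpret L: module_hom "\<lambda>c f x. c *s f x" "\<lambda>c f x. c *s f x" "slot_sum D"
    by (rule module_hom_slot_sum) unfold_locales
  \<comment> \<open>The minus sign is absorbed into \<open>R\<close>, so that
    \<open>deriv_map D\<close> is the sum of \<open>slot_sum D\<close> and \<open>R\<close> on all
    maps. This allows \<open>M = UNIV\<close> below.\<close>
  define R where "R \<psi> = (\<lambda>ws. - D (\<psi> ws))" for \<psi> :: "'w list \<Rightarrow> 'w"
  have R: "module_hom (\<lambda>c f x. c *s f x) (\<lambda>c f x. c *s f x) R"
    by unfold_locales (auto simp: R_def D.add D.scale)
  have R_sq: "(R ^^ Suc (Suc k)) \<psi> = 0" for k \<psi>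
  proof -
    have "R (R \<psi>) = 0" by (simp add: R_def D.neg sq fun_eq_iff)
    then show ?thesis
      using module_hom.zero[OF module_hom_funpow[OF R]] by (simp add: funpow_swap1)
  qed
  have comm: "slot_sum D (R \<psi>) = R (slot_sum D \<psi>)" for \<psi>
    by (simp add: slot_sum_def R_def D.sum sum_negf fun_eq_iff)
  have "(deriv_map D ^^ Suc n) \<phi> =
      (\<Sum>k\<le>Suc n. (\<lambda>ws. of_nat (Suc n choose k) *s (R ^^ k) ((slot_sum D ^^ (Suc n - k)) \<phi>) ws))"
    by (rule F.funpow_binomial[where M = UNIV, OF L.module_hom_axioms R module_hom_deriv_map[OF D] comm])
      (auto simp: deriv_map_def R_def fun_eq_iff)
  also have "\<dots> = (\<Sum>k\<le>1. (\<lambda>ws. of_nat (Suc n choose k) *s (R ^^ k) ((slot_sum D ^^ (Suc n - k)) \<phi>) ws))"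
  proof (rule sum.mono_neutral_right)
    show "\<forall>k\<in>{..Suc n} - {..1}. (\<lambda>ws. of_nat (Suc n choose k) *s
        (R ^^ k) ((slot_sum D ^^ (Suc n - k)) \<phi>) ws) = 0"
    proof
      fix k assume "k \<in> {..Suc n} - {..1}"
      then obtain j where "k = Suc (Suc j)" by (cases k rule: nat.exhaust) (auto simp: Suc_le_eq gr0_conv_Suc)
      then show "(\<lambda>ws. of_nat (Suc n choose k) *s (R ^^ k) ((slot_sum D ^^ (Suc n - k)) \<phi>) ws) = 0"
        by (simp only: R_sq) (simp add: fun_eq_iff)
    qed
  qed auto
  finally have "(deriv_map D ^^ Suc n) \<phi> ws =
      (slot_sum D ^^ Suc n) \<phi> ws - of_nat (Suc n) *s D ((slot_sum D ^^ n) \<phi> ws)"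
    by (simp add: sum_apply R_def)
  moreover have "(slot_sum D ^^ Suc n) \<phi> ws = fact (Suc n) *s \<phi> (map D ws)"
  proof -
    have "{A. A \<subseteq> {..<Suc n} \<and> card A = Suc n} = {{..<Suc n}}"
      by (auto dest: card_subset_eq[rotated])
    moreover have "apply_on D {..<Suc n} ws = map D ws"
      using len by (simp add: list_eq_iff_nth_eq nth_apply_on)
    ultimately show ?thesis
      by (subst slot_sum_funpow[where D = D and \<phi> = \<phi>, OF D.m1.module_axioms sq \<phi>]) (simp_all add: len del: fact_Suc)
  qed
  moreover have "(slot_sum D ^^ n) \<phi> ws =
      fact n *s (\<Sum>i<Suc n. \<phi> (apply_on D ({..<Suc n} - {i}) ws))"
  proof -
    have "(\<Sum>A | A \<subseteq> {..<Suc n} \<and> card A = n. \<phi> (apply_on D A ws)) =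
        (\<Sum>i<Suc n. \<phi> (apply_on D ({..<Suc n} - {i}) ws))"
    \<comment> \<open>A set of \<open>n\<close> among \<open>Suc n\<close> slots is indexed by the
      slot it misses.\<close>
    proof (rule sum.reindex_cong[of "\<lambda>i. {..<Suc n} - {i}"])
      show "{A. A \<subseteq> {..<Suc n} \<and> card A = n} = (\<lambda>i. {..<Suc n} - {i}) ` {..<Suc n}"
      proof (intro equalityI subsetI)
        fix A assume "A \<in> {A. A \<subseteq> {..<Suc n} \<and> card A = n}"
        then have A: "A \<subseteq> {..<Suc n}" "card A = n" by auto
        have "card ({..<Suc n} - A) = 1"
          using A by (subst card_Diff_subset) (auto intro: finite_subset)
        then obtain i where "{..<Suc n} - A = {i}" by (auto simp: card_1_singleton_iff)
        then show "A \<in> (\<lambda>i. {..<Suc n} - {i}) ` {..<Suc n}"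
          using A by (intro image_eqI[of _ _ i]) auto
      qed auto
    qed (auto simp: inj_on_def)
    then show ?thesis
      by (subst slot_sum_funpow[where D = D and \<phi> = \<phi>, OF D.m1.module_axioms sq \<phi>]) (simp_all add: len)
  qed
  ultimately show ?thesis
    by (simp add: D.scale D.sum D.m1.scale_right_diff_distrib del: of_nat_Suc sum.lessThan_Suc)
qed

section \<open>Bracketing degree 1 cochains with linear maps\<close>

lemma shuffle_perms_0_0: "shuffle_perms 0 0 = {id}"
  and shuffle_perms_1_0: "shuffle_perms (Suc 0) 0 = {id}"
  and shuffle_perms_0_1: "shuffle_perms 0 (Suc 0) = {id}"
  by (auto simp: shuffle_perms_def permutes_sing strict_mono_on_def)

text \<open>Turns an n-ary map into a cochain, so that brackets can be computed as operations on
  n-ary maps.\<close>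

definition degree1 :: "nat \<Rightarrow> ('w list \<Rightarrow> 'w) \<Rightarrow> ('w, 'w::zero) cochain" where
  "degree1 n \<phi> = (\<lambda>Xs x. if length Xs = 1 \<and> blocks n Xs then \<phi> (hd Xs @ [x]) else 0)"

text \<open>The operator \<open>D\<close> of the overview. It reads only the V component and has
  values in g, so two such operators coming from linear maps compose to zero.\<close>

definition extend :: "('v \<Rightarrow> 'g) \<Rightarrow> 'g \<times> 'v \<Rightarrow> 'g::zero \<times> 'v::zero" where
  "extend T w = (T (snd w), 0)"

lemma degree0_apply: "degree0 T Xs x = (if Xs = [] then extend T x else 0)"
  by (simp add: degree0_def lift_cochain_def extend_def zero_prod_def)

lemma degree1_length: "length Xs \<noteq> 1 \<Longrightarrow> degree1 n \<phi> Xs x = 0"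
  by (simp add: degree1_def)

text \<open>All pairs \<open>p\<close>, \<open>q\<close> are treated because the bracket sums over
  all degree splittings. For \<open>p \<noteq> 1\<close> the outer cochain vanishes; for
  \<open>q \<noteq> 0\<close> the inner one does, which puts a zero among the arguments of
  \<open>\<phi>\<close>.\<close>

lemma nlie_circ_degree1_degree0:
  fixes T :: "'v::ab_group_add \<Rightarrow> 'g::ab_group_add"
  assumes "module s" and \<phi>: "multiadditive \<phi>"
    and len: "length Xs = p + q" and Xs: "blocks n Xs" and n: "n \<ge> 1"
  shows "nlie_circ n s p q (degree1 n \<phi>) (degree0 T) Xs x =
    (if p = 1 \<and> q = 0 then slot_sum (extend T) \<phi> (hd Xs @ [x]) else 0)"
proof -
  interpret module s by fact
  consider "p \<noteq> 1" | "p = 1" "q \<noteq> 0" | "p = 1" "q = 0" by blast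
  then show ?thesis
  proof cases
    case 1
    then show ?thesis by (simp add: nlie_circ_def degree1_length)
  next
    case 2
    \<comment> \<open>For \<open>p = 1\<close> only \<open>k = 1\<close> occurs, and the block
      \<open>X (k + q)\<close> is \<open>Xs ! q\<close> when counted from 0.\<close>
    have "degree1 n \<phi> [(Xs ! q)[i := 0]] x = 0" if "i < n - 1" for i
    proof -
      have "Xs ! q \<in> set Xs" using len 2 by simp
      then have "length (Xs ! q) = n - 1" using Xs by (simp add: blocks_def)
      then have "0 \<in> set ((Xs ! q)[i := 0] @ [x])" using that by (simp add: set_update_memI)
      then show ?thesis by (simp add: degree1_def multiadditive_zero[OF \<phi>])
    qed
    moreover have "degree1 n \<phi> Ys 0 = 0" for Ys
      by (simp add: degree1_def multiadditive_zero[OF \<phi>])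
    ultimately show ?thesis using 2
      by (simp add: nlie_circ_def degree0_apply)
  next
    case 3
    then obtain X where X: "Xs = [X]" using len by (auto simp: length_Suc_conv)
    with Xs n have len_X: "length X = n - 1" "length (X @ [x]) = Suc (n - 1)" by (auto simp: blocks_def)
    \<comment> \<open>The first sum of \<open>nlie_circ\<close> applies \<open>extend T\<close> to
      the entries of the block, the second to \<open>x\<close>; together they cover every
      slot.\<close>
    show ?thesis using 3 len_X(1)
      by (simp add: nlie_circ_def degree0_apply degree1_def blocks_def X shuffle_perms_0_0
          shuffle_perms_1_0 slot_sum_def len_X(2) nth_append list_update_append Let_def)
  qed
qed

text \<open>In degree \<open>q = 0\<close> the outer cochain has no block for an insertion, so only
  composition from outside remains. The condition \<open>T 0 = 0\<close> handles a vanishing inner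
  cochain.\<close>

lemma nlie_circ_degree0_degree1:
  fixes T :: "'v::ab_group_add \<Rightarrow> 'g::ab_group_add"
  assumes "module s" "T 0 = 0" "length Xs = p + q" "blocks n Xs"
  shows "nlie_circ n s q p (degree0 T) (degree1 n \<phi>) Xs x =
    (if p = 1 \<and> q = 0 then extend T (\<phi> (hd Xs @ [x])) else 0)"
proof -
  interpret module s by fact
  consider "q \<noteq> 0" | "p \<noteq> 1" "q = 0" | "p = 1" "q = 0" by blast
  then show ?thesis
  proof cases
    case 1
    then show ?thesis by (simp add: nlie_circ_def degree0_apply)
  next
    case 2
    moreover have "degree0 T [] 0 = 0"
      by (simp add: degree0_apply extend_def assms(2) zero_prod_def)
    ultimately show ?thesis by (simp add: nlie_circ_def degree1_length)
  next
    case 3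
    then obtain X where "Xs = [X]" using assms(3) by (auto simp: length_Suc_conv)
    then show ?thesis using 3 assms(4)
      by (simp add: nlie_circ_def degree0_apply degree1_def blocks_def shuffle_perms_0_1 Let_def)
  qed
qed

text \<open>Only the splitting \<open>p = 1\<close>, \<open>q = 0\<close> contributes. Its sign is
  \<open>+1\<close>, which leaves the slot sum minus the outer composite.\<close>

lemma nlie_bracket_degree1_degree0:
  fixes T :: "'v::ab_group_add \<Rightarrow> 'g::ab_group_add"
  assumes "module s" "multiadditive \<phi>" "T 0 = 0" "n \<ge> 1"
  shows "nlie_bracket n s (degree1 n \<phi>) (degree0 T) = degree1 n (deriv_map (extend T) \<phi>)"
proof (intro ext)
  fix Xs :: "('g \<times> 'v) list list" and x
  interpret module s by fact
  show "nlie_bracket n s (degree1 n \<phi>) (degree0 T) Xs x = degree1 n (deriv_map (extend T) \<phi>) Xs x"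
  proof (cases "blocks n Xs")
    case True
    have "nlie_bracket n s (degree1 n \<phi>) (degree0 T) Xs x =
        (\<Sum>q\<le>length Xs. if length Xs - q = 1 \<and> q = 0 then deriv_map (extend T) \<phi> (hd Xs @ [x]) else 0)"
      unfolding nlie_bracket_def Let_def if_P[OF True]
    proof (rule sum.cong[OF refl])
      fix q assume "q \<in> {..length Xs}"
      then have "length Xs = (length Xs - q) + q" by simp
      note circ = nlie_circ_degree1_degree0[OF assms(1,2) this True assms(4)]
        nlie_circ_degree0_degree1[where T = T, OF assms(1,3) this True]
      show "nlie_circ n s (length Xs - q) q (degree1 n \<phi>) (degree0 T) Xs x -
          s ((-1) ^ ((length Xs - q) * q)) (nlie_circ n s q (length Xs - q) (degree0 T) (degree1 n \<phi>) Xs x) =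
          (if length Xs - q = 1 \<and> q = 0 then deriv_map (extend T) \<phi> (hd Xs @ [x]) else 0)"
        unfolding circ by (cases "q = 0") (simp_all add: deriv_map_def)
    qed
    also have "\<dots> = (\<Sum>q\<in>{0}. if length Xs - q = 1 \<and> q = 0 then deriv_map (extend T) \<phi> (hd Xs @ [x]) else 0)"
      by (rule sum.mono_neutral_right) auto
    finally show ?thesis by (simp add: degree1_def True)
  qed (simp add: nlie_bracket_def degree1_def)
qed

text \<open>Since \<open>foldl\<close> brackets from the left, \<open>\<phi>\<close> is generalized
  in the induction and replaced by its derivative at each step.\<close>

lemma foldl_nlie_bracket:
  fixes T :: "'v::ab_group_add \<Rightarrow> 'g::ab_group_add"
  assumes "module s" "multiadditive \<phi>" "additive T" "n \<ge> 1"
  shows "foldl (nlie_bracket n s) (degree1 n \<phi>) (replicate k (degree0 T)) =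
    degree1 n ((deriv_map (extend T) ^^ k) \<phi>)"
  using assms(2)
proof (induction k arbitrary: \<phi>)
  case (Suc k)
  have "additive (extend T)"
    by unfold_locales (simp add: extend_def additive.add[OF assms(3)])
  with Suc show ?case
    by (simp add: nlie_bracket_degree1_degree0[where T = T, OF assms(1) _ additive.zero[OF assms(3)] assms(4)]
        multiadditive_deriv_map funpow_swap1)
qed simp

section \<open>The bracket on the semidirect product and its additivity\<close>

text \<open>The value \<open>0\<close> off length \<open>n\<close> makes additivity in each slot hold on lists of every length.\<close>

definition semidirect ::
  "nat \<Rightarrow> ('k::field \<Rightarrow> 'v::ab_group_add \<Rightarrow> 'v) \<Rightarrow> ('g::ab_group_add list \<Rightarrow> 'g)
    \<Rightarrow> ('g list \<Rightarrow> 'v \<Rightarrow> 'v) \<Rightarrow> ('g \<times> 'v) list \<Rightarrow> 'g \<times> 'v" where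
  "semidirect n sV br \<rho> ws = (if length ws = n then
     (br (map fst ws),
      \<Sum>i=1..n. sV ((-1) ^ (n - i)) (\<rho> (omit i (map fst ws)) (snd (ws ! (i - 1)))))
   else 0)"

text \<open>For \<open>n \<ge> 1\<close> a block followed by the last argument has length
  \<open>n\<close>, so the default value in \<open>semidirect\<close> is not reached.\<close>

lemma mu_plus_rho_eq: "n \<ge> 1 \<Longrightarrow> mu_plus_rho n sV br \<rho> = degree1 n (semidirect n sV br \<rho>)"
  by (auto simp: mu_plus_rho_def degree1_def semidirect_def blocks_def fun_eq_iff length_Suc_conv)

lemma omit_update_same: "i \<ge> 1 \<Longrightarrow> omit i (xs[i - 1 := a]) = omit i xs"
  by (simp add: omit_def)

text \<open>The position \<open>k\<close> is \<open>j\<close> or \<open>j - 1\<close>, according to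
  the side of the omitted entry. It is the same for all \<open>a\<close>, as a comparison of several
  values in one slot requires.\<close>

lemma omit_update:
  assumes "j < length xs" "j \<noteq> i - 1" "i \<ge> 1" "i \<le> length xs"
  obtains k where "k < length xs - 1" "\<And>a. omit i (xs[j := a]) = (omit i xs)[k := a]"
proof (cases "j < i - 1")
  case True
  with that[of j] show ?thesis using assms
    by (auto simp: omit_def take_update_swap list_update_append)
next
  case False
  with that[of "j - 1"] show ?thesis using assms
    by (auto simp: omit_def drop_update_swap list_update_append)
qed

lemma length_omit: "i \<ge> 1 \<Longrightarrow> i \<le> length xs \<Longrightarrow> length (omit i xs) = length xs - 1"
  by (simp add: omit_def)

lemma alternating_map_add:
  assumes "alternating_map m sU sZ f" "length xs = m" "i < m"
  shows "f (xs[i := a + b]) = f (xs[i := a]) + f (xs[i := b])"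
  using assms by (auto simp: alternating_map_def dest!: module_hom.add[OF iffD2[OF module_hom_iff_linear]])

lemma multiadditive_semidirect:
  fixes sg :: "'k::field \<Rightarrow> 'g::ab_group_add \<Rightarrow> 'g" and sV :: "'k \<Rightarrow> 'v::ab_group_add \<Rightarrow> 'v"
  assumes "n_lierep_pair n sg sV br \<rho>" "vector_space sV"
  shows "multiadditive (semidirect n sV br \<rho>)"
  unfolding multiadditive_def
proof (intro allI impI)
  fix ws :: "('g \<times> 'v) list" and j a b assume j: "j < length ws"
  interpret vector_space sV by fact
  show "semidirect n sV br \<rho> (ws[j := a + b]) =
      semidirect n sV br \<rho> (ws[j := a]) + semidirect n sV br \<rho> (ws[j := b])"
  proof (cases "length ws = n")
    case True
    have br: "alternating_map n sg sg br"
      and \<rho>_lin: "\<And>X. length X = n - 1 \<Longrightarrow> Vector_Spaces.linear sV sV (\<rho> X)"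
      and \<rho>: "\<And>v. alternating_map (n - 1) sg sV (\<lambda>X. \<rho> X v)"
      using assms(1) by (auto simp: n_lierep_pair_def n_lie_algebra_def n_lie_representation_def)
    have "\<rho> (omit i (map fst (ws[j := a + b]))) (snd (ws[j := a + b] ! (i - 1))) =
        \<rho> (omit i (map fst (ws[j := a]))) (snd (ws[j := a] ! (i - 1))) +
        \<rho> (omit i (map fst (ws[j := b]))) (snd (ws[j := b] ! (i - 1)))" if i: "i \<in> {1..n}" for i
    \<comment> \<open>In the summand \<open>i\<close> the slot \<open>i - 1\<close> holds the vector
      on which \<open>\<rho>\<close> acts; every other slot is an argument of \<open>\<rho>\<close>
      itself.\<close>
    proof (cases "j = i - 1")
      case True
      have "length (omit i (map fst ws)) = n - 1"
        using i \<open>length ws = n\<close> by (simp add: length_omit)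
      then show ?thesis
        using module_hom.add[OF iffD2[OF module_hom_iff_linear, OF \<rho>_lin]] i j
        by (simp add: True map_update omit_update_same[simplified])
    next
      case False
      obtain k where k: "k < length (map fst ws) - 1"
        "\<And>c. omit i ((map fst ws)[j := c]) = (omit i (map fst ws))[k := c]"
        by (rule omit_update[of j "map fst ws" i]) (use False i j \<open>length ws = n\<close> in auto)
      have "length (omit i (map fst ws)) = n - 1"
        using i \<open>length ws = n\<close> by (simp add: length_omit)
      then show ?thesis
        using alternating_map_add[OF \<rho>] k \<open>length ws = n\<close> False
        by (simp add: map_update)
    qed
    then show ?thesis
      using alternating_map_add[OF br] True j
      by (simp add: semidirect_def map_update scale_right_distrib sum.distrib)
  qed (simp add: semidirect_def)
qed

section \<open>The Rota-Baxter defect as a top power of the derivation\<close>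

lemma map_fst_extend: "map fst (map (extend T) ws) = map T (map snd ws)"
  and map_snd_extend: "i < length ws \<Longrightarrow> snd (map (extend T) ws ! i) = 0"
  by (simp_all add: extend_def)

lemma omit_apply_on_extend:
  assumes "i < length ws"
  shows "omit (Suc i) (map fst (apply_on (extend T) ({..<length ws} - {i}) ws)) =
    map T (omit (Suc i) (map snd ws))"
proof -
  let ?xs = "map fst (apply_on (extend T) ({..<length ws} - {i}) ws)"
  have "?xs ! j = map T (map snd ws) ! j" if "j < length ws" "j \<noteq> i" for j
    using that by (simp add: nth_apply_on extend_def)
  then have "take i ?xs = take i (map T (map snd ws))"
    and "drop (Suc i) ?xs = drop (Suc i) (map T (map snd ws))"
    using assms by (auto simp del: map_map intro!: nth_equalityI)
  then show ?thesis by (simp add: omit_def take_map drop_map)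
qed

text \<open>Applying \<open>extend S\<close> in all slots removes every V component and leaves the
  bracket. Sparing one slot leaves a single \<open>\<rho>\<close> term, which the outer
  \<open>extend S\<close> carries to g while discarding the bracket component.\<close>

lemma deriv_map_extend_funpow:
  fixes sg :: "'k::field_char_0 \<Rightarrow> 'g::ab_group_add \<Rightarrow> 'g"
    and sV :: "'k \<Rightarrow> 'v::ab_group_add \<Rightarrow> 'v"
  assumes pair: "n_lierep_pair n sg sV br \<rho>" and S: "Vector_Spaces.linear sV sg S"
    and n: "n \<ge> 1" and len: "length ws = n"
  defines "us \<equiv> map snd ws"
  shows "(deriv_map (extend S) ^^ n) (semidirect n sV br \<rho>) ws =
    (sg (fact n) (br (map S us) -
      (\<Sum>i=1..n. sg ((-1) ^ (n - i)) (S (\<rho> (map S (omit i us)) (us ! (i - 1)))))), 0)"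
proof -
  interpret S: Vector_Spaces.linear sV sg S by fact
  interpret P: vector_space_prod sg sV by unfold_locales
  let ?\<phi> = "semidirect n sV br \<rho>"
  have S_hom: "module_hom P.scale P.scale (extend S)"
    by unfold_locales (simp_all add: extend_def P.scale_def S.add S.scale)
  have sq: "extend S (extend S w) = 0" for w
    by (simp add: extend_def zero_prod_def)
  have \<rho>_zero: "\<rho> X 0 = 0" if "length X = n - 1" for X
  proof -
    have "Vector_Spaces.linear sV sV (\<rho> X)"
      using pair that by (simp add: n_lierep_pair_def n_lie_representation_def)
    then show ?thesis by (rule module_hom.zero[OF iffD2[OF module_hom_iff_linear]])
  qed
  have "?\<phi> (map (extend S) ws) = (br (map S us), 0)"
  proof -
    have "\<rho> (omit i (map S us)) (snd (map (extend S) ws ! (i - 1))) = 0" if "i \<in> {1..n}" for i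
      using that len by (subst map_snd_extend) (auto simp: us_def length_omit intro!: \<rho>_zero)
    then show ?thesis
      unfolding semidirect_def map_fst_extend us_def[symmetric] using len by simp
  qed
  moreover have "extend S (?\<phi> (apply_on (extend S) ({..<n} - {i}) ws)) =
      (sg ((-1) ^ (n - Suc i)) (S (\<rho> (map S (omit (Suc i) us)) (us ! i))), 0)" if i: "i < n" for i
  proof -
    let ?ws = "apply_on (extend S) ({..<n} - {i}) ws"
    \<comment> \<open>Only slot \<open>i\<close> keeps a V component; as \<open>omit\<close> counts
      from 1, it belongs to the summand \<open>Suc i\<close>.\<close>
    have "(\<Sum>j=1..n. sV ((-1) ^ (n - j)) (\<rho> (omit j (map fst ?ws)) (snd (?ws ! (j - 1))))) =
        (\<Sum>j\<in>{Suc i}. sV ((-1) ^ (n - j)) (\<rho> (omit j (map fst ?ws)) (snd (?ws ! (j - 1)))))"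
    proof (rule sum.mono_neutral_right)
      show "\<forall>j\<in>{1..n} - {Suc i}.
          sV ((-1) ^ (n - j)) (\<rho> (omit j (map fst ?ws)) (snd (?ws ! (j - 1)))) = 0"
      proof
        fix j assume j: "j \<in> {1..n} - {Suc i}"
        then have "snd (?ws ! (j - 1)) = 0"
          using len by (auto simp: nth_apply_on extend_def)
        with j show "sV ((-1) ^ (n - j)) (\<rho> (omit j (map fst ?ws)) (snd (?ws ! (j - 1)))) = 0"
          using len by (simp add: \<rho>_zero length_omit)
      qed
    qed (use i in auto)
    also have "\<dots> = sV ((-1) ^ (n - Suc i)) (\<rho> (map S (omit (Suc i) us)) (us ! i))"
      using i len omit_apply_on_extend[of i ws S] by (simp add: nth_apply_on us_def)
    finally show ?thesis
      by (simp add: extend_def semidirect_def len S.scale)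
  qed
  ultimately have "(deriv_map (extend S) ^^ n) ?\<phi> ws = P.scale (fact n) ((br (map S us), 0) -
      (\<Sum>i<n. (sg ((-1) ^ (n - Suc i)) (S (\<rho> (map S (omit (Suc i) us)) (us ! i))), 0)))"
    using deriv_map_funpow[where D = "extend S" and \<phi> = ?\<phi> and n = "n - 1" and ws = ws,
        OF S_hom sq multiadditive_semidirect[OF pair S.vs1.vector_space_axioms]]
      n len by (simp del: funpow.simps fact_Suc)
  also have "(\<Sum>i<n. (sg ((-1) ^ (n - Suc i)) (S (\<rho> (map S (omit (Suc i) us)) (us ! i))), 0 :: 'v)) =
      (\<Sum>i=1..n. sg ((-1) ^ (n - i)) (S (\<rho> (map S (omit i us)) (us ! (i - 1)))), 0)"
    by (simp add: sum_prod sum.atLeast1_atMost_eq)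
  finally show ?thesis by (simp add: P.scale_def)
qed

text \<open>In characteristic 0 the factor \<open>n!\<close> is nonzero and can be
  cancelled.\<close>

lemma relative_rota_baxter_iff_deriv_map:
  fixes sg :: "'k::field_char_0 \<Rightarrow> 'g::ab_group_add \<Rightarrow> 'g"
    and sV :: "'k \<Rightarrow> 'v::ab_group_add \<Rightarrow> 'v"
  assumes "n_lierep_pair n sg sV br \<rho>" "Vector_Spaces.linear sV sg S" "n \<ge> 1"
  shows "relative_rota_baxter n sg sV br \<rho> S \<longleftrightarrow>
    (\<forall>ws. length ws = n \<longrightarrow> (deriv_map (extend S) ^^ n) (semidirect n sV br \<rho>) ws = 0)"
proof -
  interpret S: Vector_Spaces.linear sV sg S by fact
  define E where "E us = br (map S us) -
      (\<Sum>i=1..n. sg ((-1) ^ (n - i)) (S (\<rho> (map S (omit i us)) (us ! (i - 1)))))" for us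
  have "relative_rota_baxter n sg sV br \<rho> S \<longleftrightarrow> (\<forall>us. length us = n \<longrightarrow> E us = 0)"
    using assms(2) by (simp add: relative_rota_baxter_def E_def)
  also have "\<dots> \<longleftrightarrow> (\<forall>ws. length (ws :: ('g \<times> 'v) list) = n \<longrightarrow> E (map snd ws) = 0)"
  proof (intro iffI allI impI)
    fix us :: "'v list"
    assume "\<forall>ws. length (ws :: ('g \<times> 'v) list) = n \<longrightarrow> E (map snd ws) = 0" "length us = n"
    then show "E us = 0"
      \<comment> \<open>The defect sees only V components, so \<open>us\<close> is lifted to W with
        zero g components.\<close>
      by (auto dest!: spec[of _ "map (Pair 0) us"] simp: comp_def)
  qed simp
  also have "\<dots> \<longleftrightarrow>
      (\<forall>ws. length ws = n \<longrightarrow> (deriv_map (extend S) ^^ n) (semidirect n sV br \<rho>) ws = 0)"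
    using deriv_map_extend_funpow[OF assms] by (auto simp: E_def zero_prod_def)
  finally show ?thesis .
qed

section \<open>The Maurer-Cartan equation of the twisted algebra\<close>

text \<open>The coefficients \<open>1 / k!\<close> and \<open>1 / (n - k)!\<close> multiply to
  \<open>1 / n!\<close> times \<open>n choose k\<close>. The twisted sum starts at
  \<open>k = 1\<close>, and the missing term \<open>k = 0\<close> is the subtracted power for
  \<open>T\<close>.\<close>

lemma twisted_maurer_cartan_sum:
  fixes sg :: "'k::field_char_0 \<Rightarrow> 'g::ab_group_add \<Rightarrow> 'g"
    and sV :: "'k \<Rightarrow> 'v::ab_group_add \<Rightarrow> 'v"
  assumes pair: "n_lierep_pair n sg sV br \<rho>" and n: "n \<ge> 1"
    and T: "Vector_Spaces.linear sV sg T" and T': "Vector_Spaces.linear sV sg T'"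
  defines "s \<equiv> module_prod.scale sg sV" and "\<phi> \<equiv> semidirect n sV br \<rho>"
  shows "(\<Sum>k=1..n. cochain_scale s (1 / fact k)
      (twisted_bracket n sg sV br \<rho> T k (replicate k (degree0 T')))) =
    cochain_scale s (1 / fact n) (degree1 n (\<lambda>ws.
      (deriv_map (extend (\<lambda>v. T v + T' v)) ^^ n) \<phi> ws - (deriv_map (extend T) ^^ n) \<phi> ws))"
proof -
  interpret T: Vector_Spaces.linear sV sg T by fact
  interpret T': Vector_Spaces.linear sV sg T' by fact
  interpret P: vector_space_prod sg sV
    rewrites "P.scale = s" by unfold_locales (simp add: s_def)
  interpret F: module "\<lambda>c f x. s c (f x)" by (rule module_pointwise) unfold_locales
  define S where "S v = T v + T' v" for v
  let ?A = "deriv_map (extend T)" and ?B = "deriv_map (extend T')" and ?C = "deriv_map (extend S)"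
  have hom: "module_hom s s (extend T)" "module_hom s s (extend T')" "module_hom s s (extend S)"
    by (unfold_locales; simp add: extend_def P.scale_def S_def T.add T.scale T'.add T'.scale
        T.vs2.scale_right_distrib)+
  have add: "additive T" "additive T'" "additive (extend T)" "additive (extend T')"
    by (unfold_locales; simp add: extend_def T.add T'.add)+
  have \<phi>: "multiadditive \<phi>"
    unfolding \<phi>_def by (rule multiadditive_semidirect[OF pair]) unfold_locales
  have extend_S: "extend S = (\<lambda>w. extend T w + extend T' w)"
    by (auto simp: extend_def S_def)
  have comm: "?A (?B \<psi>) = ?B (?A \<psi>)" for \<psi>
    by (rule deriv_map_commute[OF add(3,4)]) (simp add: extend_def T.zero T'.zero)
  have binom: "(?C ^^ n) \<phi> ws = (\<Sum>k\<le>n. s (of_nat (n choose k)) ((?B ^^ k) ((?A ^^ (n - k)) \<phi>) ws))" for ws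
  proof -
    have C: "?C \<psi> = ?A \<psi> + ?B \<psi>" if "multiadditive \<psi>" for \<psi>
      unfolding extend_S by (rule deriv_map_add_left[OF that])
    have "(?C ^^ n) \<phi> = (\<Sum>k\<le>n. (\<lambda>ws. s (of_nat (n choose k)) ((?B ^^ k) ((?A ^^ (n - k)) \<phi>) ws)))"
      by (rule F.funpow_binomial[where M = "Collect multiadditive",
            OF hom[THEN module_hom_deriv_map] comm])
        (simp_all add: C \<phi> multiadditive_deriv_map add)
    then show ?thesis by (simp add: sum_apply)
  qed
  have bracket: "twisted_bracket n sg sV br \<rho> T k (replicate k (degree0 T')) =
      cochain_scale s (1 / fact (n - k)) (degree1 n ((?B ^^ k) ((?A ^^ (n - k)) \<phi>)))"
    if "k \<in> {1..n}" for k
  proof -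
    \<comment> \<open>The copies of \<open>T\<close> come first in the bracket, so the iteration for
      \<open>T'\<close> starts from a derivative of \<open>\<phi>\<close>.\<close>
    have "multiadditive ((?A ^^ m) \<phi>)" for m
      by (induction m) (auto simp: \<phi> intro: multiadditive_deriv_map add)
    then show ?thesis
      using that n by (simp add: twisted_bracket_def nary_bracket_def s_def[symmetric] mu_plus_rho_eq
          \<phi>_def[symmetric] foldl_nlie_bracket[OF P.p.module_axioms] \<phi> add)
  qed
  have "(\<Sum>k=1..n. s (1 / fact k) (s (1 / fact (n - k)) ((?B ^^ k) ((?A ^^ (n - k)) \<phi>) ws))) =
      s (1 / fact n) ((?C ^^ n) \<phi> ws - (?A ^^ n) \<phi> ws)" for ws
  proof -
    have "(?C ^^ n) \<phi> ws - (?A ^^ n) \<phi> ws =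
        (\<Sum>k=1..n. s (of_nat (n choose k)) ((?B ^^ k) ((?A ^^ (n - k)) \<phi>) ws))"
      unfolding binom by (simp add: atMost_atLeast0 sum.atLeast_Suc_atMost)
    then show ?thesis
      by (auto simp: P.p.scale_sum_right binomial_fact intro!: sum.cong)
  qed
  then show ?thesis
    by (auto simp: fun_eq_iff sum_apply bracket cochain_scale_def degree1_def S_def[abs_def])
qed

text \<open>The brackets vanish above \<open>n\<close>, so the support of the series lies in
  \<open>{1..n}\<close>; the added indices contribute only zeros.\<close>

lemma maurer_cartan_iff_sum:
  assumes s_zero: "\<And>c. s c 0 = 0" and "\<alpha> \<in> L 0" and l: "\<And>k Ps. k > n \<Longrightarrow> l k Ps = 0"
  shows "maurer_cartan s L l \<alpha> \<longleftrightarrow> (\<Sum>k=1..n. s (1 / fact k) (l k (replicate k \<alpha>))) = 0"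
proof -
  let ?K = "{k. k \<ge> 1 \<and> l k (replicate k \<alpha>) \<noteq> 0}"
  have sub: "?K \<subseteq> {1..n}" using l by (auto simp: not_less[symmetric])
  then have "(\<Sum>k\<in>?K. s (1 / fact k) (l k (replicate k \<alpha>))) =
      (\<Sum>k=1..n. s (1 / fact k) (l k (replicate k \<alpha>)))"
    by (intro sum.mono_neutral_left) (auto simp: s_zero)
  then show ?thesis
    using assms(2) finite_subset[OF sub] by (simp add: maurer_cartan_def)
qed

lemma degree0_in_cochains_V_g:
  assumes "Vector_Spaces.linear sV sg T"
  shows "degree0 T \<in> cochains_V_g n sg sV 0"
  unfolding cochains_V_g_def degree0_def cochains_def
  using assms by (intro imageI) (auto simp: blocks_def)

text \<open>Passes between cochain arguments, a block and a last entry, and the lists on which n-ary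
  maps are evaluated.\<close>

lemma all_append_length_iff:
  assumes "n \<ge> 1"
  shows "(\<forall>X x. length X = n - 1 \<longrightarrow> P (X @ [x])) \<longleftrightarrow> (\<forall>ws. length ws = n \<longrightarrow> P ws)"
proof (intro iffI allI impI)
  fix ws :: "'a list" assume P: "\<forall>X x. length X = n - 1 \<longrightarrow> P (X @ [x])" and len: "length ws = n"
  then have "ws \<noteq> []" using assms by auto
  then show "P ws"
    using P[rule_format, of "butlast ws" "last ws"] len by simp
qed (use assms in simp)

theorem theorem3p12:
  fixes n :: nat
    and sg :: "'k::{alg_closed_field, field_char_0} \<Rightarrow> 'g::ab_group_add \<Rightarrow> 'g"
    and sV :: "'k \<Rightarrow> 'v::ab_group_add \<Rightarrow> 'v"
    and Bg :: "'g set" and BV :: "'v set"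
    and br :: "'g list \<Rightarrow> 'g"
    and \<rho> :: "'g list \<Rightarrow> 'v \<Rightarrow> 'v"
    and T T' :: "'v \<Rightarrow> 'g"
  assumes "n \<ge> 2"
    and "finite_dimensional_vector_space sg Bg"
    and "finite_dimensional_vector_space sV BV"
    and "n_lierep_pair n sg sV br \<rho>"
    and "relative_rota_baxter n sg sV br \<rho> T"
    and "Vector_Spaces.linear sV sg T'"
  shows "(relative_rota_baxter n sg sV br \<rho> (\<lambda>v. T v + T' v) \<longleftrightarrow>
            maurer_cartan (cochain_scale (module_prod.scale sg sV)) (cochains_V_g n sg sV)
              (twisted_bracket n sg sV br \<rho> T) (degree0 T')) \<and>
         (maurer_cartan (cochain_scale (module_prod.scale sg sV)) (cochains_V_g n sg sV)
              (twisted_bracket n sg sV br \<rho> T) (degree0 T') \<longleftrightarrow>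
            (\<Sum>k=1..n. cochain_scale (module_prod.scale sg sV) (1 / fact k)
               (twisted_bracket n sg sV br \<rho> T k (replicate k (degree0 T')))) = 0)"
proof -
  have n: "n \<ge> 1" using assms(1) by simp
  have T: "Vector_Spaces.linear sV sg T"
    using assms(5) by (simp add: relative_rota_baxter_def)
  interpret T: Vector_Spaces.linear sV sg T by fact
  interpret T': Vector_Spaces.linear sV sg T' by fact
  interpret P: vector_space_prod sg sV by unfold_locales
  define S where "S v = T v + T' v" for v
  have S: "Vector_Spaces.linear sV sg S"
    by unfold_locales (simp_all add: S_def T.add T.scale T'.add T'.scale T.vs2.scale_right_distrib)
  let ?\<phi> = "semidirect n sV br \<rho>"
  have "(\<Sum>k=1..n. cochain_scale P.scale (1 / fact k)
      (twisted_bracket n sg sV br \<rho> T k (replicate k (degree0 T')))) = 0 \<longleftrightarrow>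
    (\<forall>ws. length ws = n \<longrightarrow> (deriv_map (extend S) ^^ n) ?\<phi> ws - (deriv_map (extend T) ^^ n) ?\<phi> ws = 0)"
    (is "?sum = 0 \<longleftrightarrow> (\<forall>ws. length ws = n \<longrightarrow> ?d ws = 0)")
  proof -
    have sum_eq: "?sum = cochain_scale P.scale (1 / fact n) (degree1 n ?d)"
      unfolding S_def by (rule twisted_maurer_cartan_sum[OF assms(4) n T assms(6)])
    have "?sum = 0 \<longleftrightarrow> (\<forall>X x. length X = n - 1 \<longrightarrow> ?d (X @ [x]) = 0)"
      unfolding sum_eq
      by (auto simp: cochain_scale_def degree1_def fun_eq_iff blocks_def length_Suc_conv)
    then show ?thesis
      unfolding all_append_length_iff[where P = "\<lambda>ws. ?d ws = 0", OF n] .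
  qed
  \<comment> \<open>As \<open>T\<close> is a relative Rota-Baxter operator, its own power vanishes
    on lists of length \<open>n\<close>, leaving the power for \<open>S\<close>.\<close>
  also have "\<dots> \<longleftrightarrow> relative_rota_baxter n sg sV br \<rho> S"
    unfolding relative_rota_baxter_iff_deriv_map[OF assms(4) S n]
    using assms(5)[unfolded relative_rota_baxter_iff_deriv_map[OF assms(4) T n]]
    by (metis diff_zero)
  finally have "relative_rota_baxter n sg sV br \<rho> S \<longleftrightarrow> ?sum = 0" by (rule sym)
  moreover have "maurer_cartan (cochain_scale P.scale) (cochains_V_g n sg sV)
      (twisted_bracket n sg sV br \<rho> T) (degree0 T') \<longleftrightarrow> ?sum = 0"
    by (rule maurer_cartan_iff_sum)
      (simp_all add: cochain_scale_def fun_eq_iff degree0_in_cochains_V_g[OF assms(6)] twisted_bracket_def)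
  ultimately show ?thesis unfolding S_def[abs_def] by blast
qed

end
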